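(* Let $K$ be a field and $L=L_0\oplus L_1$ a (left) Leibniz superalgebra over $K$. The cohomology class of the infinitesimal of a formal deformation $\mu_t$ of $L$ is determined by the equivalence class of $\mu_t$; that is, if $\mu_t=\sum_{i\ge0}\mu_it^i$ and $\tilde\mu_t=\sum_{i\ge0}\tilde\mu_it^i$ are equivalent formal deformations of $L$, then $\mu_1$ and $\tilde\mu_1$ represent the same class in $H_0^2(L;L)$.
   Context: Fix a field $K$. In a $\mathbb{Z}_2$-graded space, a homogeneous element appearing in an exponent of $-1$ stands for its degree: $(-1)^{ab}=(-1)^{\deg(a)\deg(b)}$. A (left) Leibniz superalgebra is a $\mathbb{Z}_2$-graded $K$-vector space $L=L_0\oplus L_1$ with a bilinear map $[-,-]:L\times L\to L$ such that $[L_\alpha,L_\beta]\subseteq L_{\alpha+\beta}$ and $[[a,b],c]=[a,[b,c]]-(-1)^{ab}[b,[a,c]]$ for all homogeneous $a,b,c\in L$. $L[[t]]$ denotes formal power series with coefficients in $L$, a module over $K[[t]]$. A formal one-parameter deformation (formal deformation) of $L$ is a $K[[t]]$-bilinear map $\mu_t:L[[t]]\times L[[t]]\to L[[t]]$ such that (a) $\mu_t(a,b)=\sum_{i=0}^\infty\mu_i(a,b)t^i$ for all $a,b\in L$, where each $\mu_i:L\times L\to L$ is $K$-bilinear and homogeneous of degree $0$ (i.e. $\mu_i(L_\alpha,L_\beta)\subseteq L_{\alpha+\beta}$) and $\mu_0(a,b)=[a,b]$; (b) $\mu_t(\mu_t(a,b),c)=\mu_t(a,\mu_t(b,c))-(-1)^{ab}\mu_t(b,\mu_t(a,c))$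 for all homogeneous $a,b,c\in L$. The cochain $\mu_1$ is called the infinitesimal of $\mu_t$; it is always a cocycle, i.e. lies in the space $Z_0^2(L;L)$ defined below. A formal isomorphism from $\mu_t$ to $\tilde\mu_t$ is a $K[[t]]$-linear automorphism $\Psi_t:L[[t]]\to L[[t]]$ of the form $\Psi_t=\sum_{i=0}^\infty\psi_it^i$, where each $\psi_i:L\to L$ is $K$-linear and homogeneous of degree $0$, $\psi_0=\mathrm{Id}_L$, and $\tilde\mu_t(\Psi_t(a),\Psi_t(b))=\Psi_t(\mu_t(a,b))$ for all $a,b\in L$. Two deformations are equivalent if there is a formal isomorphism from one to the other (this is an equivalence relation). $C_0^n(L;L)$ is the space of $n$-linear maps $L\times\cdots\times L\to L$ homogeneous of degree $0$. For $f\in C_0^1(L;L)$, $\delta^1f(x_1,x_2)=-f([x_1,x_2])+[x_1,f(x_2)]+[f(x_1),x_2]$. For $g\in C_0^2(L;L)$ and homogeneous $x_i$, $$\begin{aligned}\delta^2g(x_1,x_2,x_3)={}&-g([x_1,x_2],x_3)-(-1)^{x_1x_2}g(x_2,[x_1,x_3])+g(x_1,[x_2,x_3])\\&+[x_1,g(x_2,x_3)]-(-1)^{x_1x_2}[x_2,g(x_1,x_3)]-[g(x_1,x_2),x_3].\end{aligned}$$ $Z_0^2(L;L)=\{g\in C_0^2(L;L):\delta^2 g=0\}$, $B_0^2(L;L)=\delta^1(C_0^1(L;L))$, $H_0^2(L;L)=Z_0^2(L;L)/B_0^2(L;L)$. *)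

theory Defs
  imports "HOL-Computational_Algebra.Formal_Power_Series" "HOL-Library.Z2"
begin

unbundle fps_syntax

text \<open>
  The sign \<open>(-1)\<^sup>a\<^sup>b\<close> for degrees \<open>a\<close>, \<open>b\<close> in \<open>bit\<close>, the field with two elements, taken
  in \<open>K\<close> or in \<open>K[[t]]\<close>.
\<close>
definition koszul_sign :: "bit \<Rightarrow> bit \<Rightarrow> 'a::ring_1" where
  "koszul_sign a b = (if a * b = 1 then - 1 else 1)"

text \<open>
  The action of \<open>K[[t]]\<close> on \<open>L[[t]]\<close>. Elements of \<open>L\<close> are regarded as elements of \<open>L[[t]]\<close>
  by means of \<^const>\<open>fps_const\<close>.
\<close>
definition fps_scale ::
  "('k::comm_ring_1 \<Rightarrow> 'v::ab_group_add \<Rightarrow> 'v) \<Rightarrow> 'k fps \<Rightarrow> 'v fps \<Rightarrow> 'v fps" where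
  "fps_scale s c x = Abs_fps (\<lambda>n. \<Sum>i=0..n. s (c $ i) (x $ (n - i)))"

definition bilinear_map ::
  "('r::comm_ring_1 \<Rightarrow> 'm::ab_group_add \<Rightarrow> 'm) \<Rightarrow> ('m \<Rightarrow> 'm \<Rightarrow> 'm) \<Rightarrow> bool" where
  "bilinear_map s f \<longleftrightarrow> (\<forall>x. module_hom s s (f x)) \<and> (\<forall>y. module_hom s s (\<lambda>x. f x y))"

text \<open>The cochain \<open>\<mu>\<^sub>i\<close>, which is determined by \<open>\<mu>\<^sub>t\<close>.\<close>
definition coeff_cochain :: "('v::zero fps \<Rightarrow> 'v fps \<Rightarrow> 'v fps) \<Rightarrow> nat \<Rightarrow> 'v \<Rightarrow> 'v \<Rightarrow> 'v" where
  "coeff_cochain \<mu> i a b = \<mu> (fps_const a) (fps_const b) $ i"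

definition infinitesimal :: "('v::zero fps \<Rightarrow> 'v fps \<Rightarrow> 'v fps) \<Rightarrow> 'v \<Rightarrow> 'v \<Rightarrow> 'v" where
  "infinitesimal \<mu> = coeff_cochain \<mu> 1"

locale super_vector_space = vector_space scale
  for scale :: "'k::field \<Rightarrow> 'v::ab_group_add \<Rightarrow> 'v" (infixr \<open>*s\<close> 75) +
  fixes L :: "bit \<Rightarrow> 'v set"
  assumes subspace_L: "subspace (L \<alpha>)"
    and L_Int: "L 0 \<inter> L 1 = {0}"
    and L_sum: "\<exists>a\<in>L 0. \<exists>b\<in>L 1. x = a + b"
begin

text \<open>\<open>C\<^sub>0\<^sup>1(L;L)\<close> and \<open>C\<^sub>0\<^sup>2(L;L)\<close>; they do not involve the bracket.\<close>

definition C1 :: "('v \<Rightarrow> 'v) set" where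
  "C1 = {f. module_hom scale scale f \<and> (\<forall>\<alpha>. \<forall>x\<in>L \<alpha>. f x \<in> L \<alpha>)}"

definition C2 :: "('v \<Rightarrow> 'v \<Rightarrow> 'v) set" where
  "C2 = {g. bilinear_map scale g \<and> (\<forall>\<alpha> \<beta>. \<forall>x\<in>L \<alpha>. \<forall>y\<in>L \<beta>. g x y \<in> L (\<alpha> + \<beta>))}"

text \<open>
  The condition on \<open>\<psi>\<close> says \<open>\<Psi> = \<Sum>\<^sub>i \<psi>\<^sub>i t\<^sup>i\<close> on all of \<open>L[[t]]\<close>, where \<open>\<psi>\<^sub>i\<close> acts on a power
  series coefficientwise.
\<close>
definition formal_isomorphism ::
  "('v fps \<Rightarrow> 'v fps) \<Rightarrow> ('v fps \<Rightarrow> 'v fps \<Rightarrow> 'v fps) \<Rightarrow> ('v fps \<Rightarrow> 'v fps \<Rightarrow> 'v fps) \<Rightarrow> bool" where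
  "formal_isomorphism \<Psi> \<mu> \<mu>' \<longleftrightarrow>
     module_hom (fps_scale scale) (fps_scale scale) \<Psi> \<and> bij \<Psi> \<and>
     (\<exists>\<psi> :: nat \<Rightarrow> 'v \<Rightarrow> 'v. (\<forall>i. \<psi> i \<in> C1) \<and> \<psi> 0 = id \<and>
        (\<forall>x n. \<Psi> x $ n = (\<Sum>i=0..n. \<psi> i (x $ (n - i))))) \<and>
     (\<forall>a b. \<mu>' (\<Psi> (fps_const a)) (\<Psi> (fps_const b)) = \<Psi> (\<mu> (fps_const a) (fps_const b)))"

definition equivalent_deformations ::
  "('v fps \<Rightarrow> 'v fps \<Rightarrow> 'v fps) \<Rightarrow> ('v fps \<Rightarrow> 'v fps \<Rightarrow> 'v fps) \<Rightarrow> bool" where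
  "equivalent_deformations \<mu> \<mu>' \<longleftrightarrow> (\<exists>\<Psi>. formal_isomorphism \<Psi> \<mu> \<mu>')"

end

locale leibniz_superalgebra = super_vector_space scale L
  for scale :: "'k::field \<Rightarrow> 'v::ab_group_add \<Rightarrow> 'v" (infixr \<open>*s\<close> 75)
    and L :: "bit \<Rightarrow> 'v set" +
  fixes br :: "'v \<Rightarrow> 'v \<Rightarrow> 'v"
  assumes br_C2: "br \<in> C2"
    and leibniz: "a \<in> L \<alpha> \<Longrightarrow> b \<in> L \<beta> \<Longrightarrow> c \<in> L \<gamma> \<Longrightarrow>
      br (br a b) c = br a (br b c) - koszul_sign \<alpha> \<beta> *s br b (br a c)"
begin

definition delta1 :: "('v \<Rightarrow> 'v) \<Rightarrow> 'v \<Rightarrow> 'v \<Rightarrow> 'v" where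
  "delta1 f x1 x2 = - f (br x1 x2) + br x1 (f x2) + br (f x1) x2"

text \<open>
  The degrees \<open>\<alpha>\<close>, \<open>\<beta>\<close> of the homogeneous elements \<open>x1\<close>, \<open>x2\<close> are passed explicitly; the degree
  of \<open>x3\<close> does not enter.
\<close>
definition delta2 :: "('v \<Rightarrow> 'v \<Rightarrow> 'v) \<Rightarrow> bit \<Rightarrow> bit \<Rightarrow> 'v \<Rightarrow> 'v \<Rightarrow> 'v \<Rightarrow> 'v" where
  "delta2 g \<alpha> \<beta> x1 x2 x3 =
     - g (br x1 x2) x3 - koszul_sign \<alpha> \<beta> *s g x2 (br x1 x3) + g x1 (br x2 x3)
     + br x1 (g x2 x3) - koszul_sign \<alpha> \<beta> *s br x2 (g x1 x3) - br (g x1 x2) x3"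

definition Z2 :: "('v \<Rightarrow> 'v \<Rightarrow> 'v) set" where
  "Z2 = {g \<in> C2. \<forall>\<alpha> \<beta> \<gamma>. \<forall>x1\<in>L \<alpha>. \<forall>x2\<in>L \<beta>. \<forall>x3\<in>L \<gamma>. delta2 g \<alpha> \<beta> x1 x2 x3 = 0}"

definition B2 :: "('v \<Rightarrow> 'v \<Rightarrow> 'v) set" where
  "B2 = delta1 ` C1"

definition cohomologous :: "(('v \<Rightarrow> 'v \<Rightarrow> 'v) \<times> ('v \<Rightarrow> 'v \<Rightarrow> 'v)) set" where
  "cohomologous = {(g, h). g \<in> Z2 \<and> h \<in> Z2 \<and> (\<lambda>x y. g x y - h x y) \<in> B2}"

definition H2 :: "('v \<Rightarrow> 'v \<Rightarrow> 'v) set set" where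
  "H2 = Z2 // cohomologous"

definition formal_deformation :: "('v fps \<Rightarrow> 'v fps \<Rightarrow> 'v fps) \<Rightarrow> bool" where
  "formal_deformation \<mu> \<longleftrightarrow>
     bilinear_map (fps_scale scale) \<mu> \<and>
     (\<forall>i. coeff_cochain \<mu> i \<in> C2) \<and>
     coeff_cochain \<mu> 0 = br \<and>
     (\<forall>\<alpha> \<beta> \<gamma>. \<forall>a\<in>L \<alpha>. \<forall>b\<in>L \<beta>. \<forall>c\<in>L \<gamma>.
        \<mu> (\<mu> (fps_const a) (fps_const b)) (fps_const c) =
        \<mu> (fps_const a) (\<mu> (fps_const b) (fps_const c))
        - fps_scale scale (koszul_sign \<alpha> \<beta>) (\<mu> (fps_const b) (\<mu> (fps_const a) (fps_const c))))"

end

lemma module_fps_scale: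
  assumes "module s"
  shows "module (fps_scale s)"
proof -
  interpret module s by fact
  show ?thesis
  proof
    fix a b :: "'a fps" and x :: "'b fps"
    show "fps_scale s a (fps_scale s b x) = fps_scale s (a * b) x"
    proof (rule fps_ext)
      fix n
      have "fps_scale s a (fps_scale s b x) $ n =
          (\<Sum>i=0..n. \<Sum>j=0..n - i. s (a $ i * b $ j) (x $ (n - i - j)))"
        by (simp add: fps_scale_def scale_sum_right)
      also have "\<dots> = (\<Sum>k=0..n. \<Sum>i=0..k. s (a $ i * b $ (k - i)) (x $ (n - i - (k - i))))"
        using sum.triangle_reindex_eq[of "\<lambda>i j. s (a $ i * b $ j) (x $ (n - i - j))" n]
        by (simp add: sum.Sigma sum.triangle_reindex_eq atLeast0AtMost Sigma_def)
           (rule sum.reindex_bij_witness[where i = "\<lambda>(k,i). (i, k - i)" and j = "\<lambda>(i,j). (i + j, i)"], auto)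
      also have "\<dots> = fps_scale s (a * b) x $ n"
        by (simp add: fps_scale_def fps_mult_nth scale_sum_left)
      finally show "fps_scale s a (fps_scale s b x) $ n = fps_scale s (a * b) x $ n" .
    qed
  next
    fix x :: "'b fps"
    have "(\<Sum>i=0..n. s ((1::'a fps) $ i) (x $ (n - i))) = x $ n" for n
    proof -
      have "(\<Sum>i=0..n. s ((1::'a fps) $ i) (x $ (n - i))) = (\<Sum>i=0..n. if i = 0 then x $ n else 0)"
        by (rule sum.cong) auto
      then show ?thesis by simp
    qed
    then show "fps_scale s 1 x = x"
      by (simp add: fps_scale_def fps_eq_iff)
  qed (simp_all add: fps_scale_def fps_eq_iff scale_right_distrib scale_left_distrib sum.distrib)
qed

context leibniz_superalgebra
begin

lemma equiv_cohomologous: "equiv Z2 cohomologous"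
proof -
  have br_hom: "module_hom scale scale (br x)" "module_hom scale scale (\<lambda>x. br x y)" for x y
    using br_C2 by (auto simp: C2_def bilinear_map_def)
  note br_simps = br_hom(1)[THEN module_hom.add] br_hom(2)[THEN module_hom.add]
    br_hom(1)[THEN module_hom.neg] br_hom(2)[THEN module_hom.neg]
  interpret P: module_pair scale scale by unfold_locales
  have zero: "(\<lambda>x y. 0) \<in> B2"
  proof -
    have "(\<lambda>x. 0) \<in> C1"
      using P.module_hom_zero subspace_0[OF subspace_L] by (simp add: C1_def)
    moreover have "delta1 (\<lambda>x. 0) = (\<lambda>x y. 0)"
      using br_hom[THEN module_hom.zero] by (simp add: delta1_def fun_eq_iff)
    ultimately show ?thesis unfolding B2_def by (metis imageI)
  qed
  have neg: "(\<lambda>x y. - g x y) \<in> B2" if "g \<in> B2" for g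
  proof -
    from that obtain f where f: "f \<in> C1" "g = delta1 f" by (auto simp: B2_def)
    have "(\<lambda>x. - f x) \<in> C1"
      using f(1) P.module_hom_neg subspace_neg[OF subspace_L] by (auto simp: C1_def)
    moreover have "delta1 (\<lambda>x. - f x) = (\<lambda>x y. - g x y)"
      by (simp add: f(2) delta1_def fun_eq_iff br_simps)
    ultimately show ?thesis unfolding B2_def by (metis imageI)
  qed
  have add: "(\<lambda>x y. g x y + h x y) \<in> B2" if "g \<in> B2" "h \<in> B2" for g h
  proof -
    from that obtain f f' where f: "f \<in> C1" "g = delta1 f" "f' \<in> C1" "h = delta1 f'"
      by (auto simp: B2_def)
    have "(\<lambda>x. f x + f' x) \<in> C1"
      using f(1,3) P.module_hom_add subspace_add[OF subspace_L] by (auto simp: C1_def)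
    moreover have "delta1 (\<lambda>x. f x + f' x) = (\<lambda>x y. g x y + h x y)"
      by (simp add: f(2,4) delta1_def fun_eq_iff br_simps)
    ultimately show ?thesis unfolding B2_def by (metis imageI)
  qed
  show ?thesis
  proof (rule equivI)
    show "cohomologous \<subseteq> Z2 \<times> Z2" by (auto simp: cohomologous_def)
    show "refl_on Z2 cohomologous" using zero by (auto simp: cohomologous_def refl_on_def)
    show "sym cohomologous" using neg by (force simp: cohomologous_def sym_def)
    show "trans cohomologous"
    proof (rule transI)
      fix g h k assume "(g, h) \<in> cohomologous" "(h, k) \<in> cohomologous"
      then show "(g, k) \<in> cohomologous"
        using add[of "\<lambda>x y. g x y - h x y" "\<lambda>x y. h x y - k x y"]
        by (auto simp: cohomologous_def)
    qed
  qed
qed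

end

end

theory Submission
  imports Defs
begin

text \<open>
  Everything happens modulo \<open>t\<^sup>2\<close>. A \<open>K[[t]]\<close>-bilinear map \<open>\<mu>\<close> on \<open>L[[t]]\<close> satisfies
  \<open>\<mu>(x\<^sub>0 + t x\<^sub>1, y\<^sub>0 + t y\<^sub>1) = \<mu>\<^sub>0(x\<^sub>0, y\<^sub>0) + t (\<mu>\<^sub>1(x\<^sub>0, y\<^sub>0) + \<mu>\<^sub>0(x\<^sub>1, y\<^sub>0) + \<mu>\<^sub>0(x\<^sub>0, y\<^sub>1))\<close>
  modulo \<open>t\<^sup>2\<close>, because each argument differs from its constant term by a multiple of \<open>t\<close>; this is
  \<open>bilinear_fps_nth_0\<close> and \<open>bilinear_fps_nth_1\<close>.

  For a deformation, \<open>\<mu>\<^sub>0\<close> is the bracket. Comparing the coefficients of \<open>t\<close> in the Leibniz identity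
  for \<open>\<mu>\<close> gives \<open>\<delta>\<^sup>2 \<mu>\<^sub>1 = 0\<close> (\<open>infinitesimal_in_Z2\<close>). If \<open>\<Psi> = Id + t \<psi>\<^sub>1 + \<dots>\<close> is a formal
  isomorphism from \<open>\<mu>\<close> to \<open>\<mu>'\<close>, then the coefficients of \<open>t\<close> in
  \<open>\<mu>'(\<Psi> a, \<Psi> b) = \<Psi>(\<mu>(a, b))\<close> are
  \<open>\<mu>'\<^sub>1(a, b) + [\<psi>\<^sub>1 a, b] + [a, \<psi>\<^sub>1 b] = \<mu>\<^sub>1(a, b) + \<psi>\<^sub>1 [a, b]\<close>, that is
  \<open>\<mu>\<^sub>1 - \<mu>'\<^sub>1 = \<delta>\<^sup>1 \<psi>\<^sub>1\<close>, so the two cocycles differ by a coboundary.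
\<close>

context module
begin

lemma fps_scale_X_nth_0: "fps_scale scale fps_X x $ 0 = 0"
  by (simp add: fps_scale_def)

lemma fps_scale_X_nth_Suc: "fps_scale scale fps_X x $ Suc n = x $ n"
proof -
  have "(\<Sum>i=0..Suc n. scale (fps_X $ i) (x $ (Suc n - i))) = (\<Sum>i=0..Suc n. if i = 1 then x $ n else 0)"
    by (rule sum.cong) (auto simp: fps_X_def)
  then show ?thesis
    by (simp add: fps_scale_def)
qed

lemma fps_const_plus_X_shift: "x = fps_const (x $ 0) + fps_scale scale fps_X (fps_shift 1 x)"
proof (rule fps_ext)
  show "x $ n = (fps_const (x $ 0) + fps_scale scale fps_X (fps_shift 1 x)) $ n" for n
    by (cases n) (simp_all add: fps_scale_X_nth_0 fps_scale_X_nth_Suc)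
qed

lemma fps_scale_koszul_sign_nth:
  "fps_scale scale (koszul_sign \<alpha> \<beta>) x $ n = scale (koszul_sign \<alpha> \<beta>) (x $ n)"
proof -
  have "(koszul_sign \<alpha> \<beta> :: 'a fps) $ i = (if i = 0 then koszul_sign \<alpha> \<beta> else 0)" for i
    by (simp add: koszul_sign_def)
  then have "(\<Sum>i=0..n. scale ((koszul_sign \<alpha> \<beta> :: 'a fps) $ i) (x $ (n - i))) =
      (\<Sum>i=0..n. if i = 0 then scale (koszul_sign \<alpha> \<beta>) (x $ n) else 0)"
    by (intro sum.cong) auto
  then show ?thesis
    by (simp add: fps_scale_def)
qed

text \<open>
  Linearity over the whole of \<open>K[[t]]\<close> enters the comparison of coefficients only through this
  rule and its mirror image: a factor \<open>t\<close> can be pulled out of an argument.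
\<close>
lemma bilinear_fps_split_left:
  assumes "bilinear_map (fps_scale scale) \<mu>"
  shows "\<mu> x y = \<mu> (fps_const (x $ 0)) y + fps_scale scale fps_X (\<mu> (fps_shift 1 x) y)"
proof -
  have hom: "module_hom (fps_scale scale) (fps_scale scale) (\<lambda>x. \<mu> x y)"
    using assms by (simp add: bilinear_map_def)
  show ?thesis
    by (subst fps_const_plus_X_shift[of x])
       (simp only: module_hom.add[OF hom] module_hom.scale[OF hom])
qed

lemma bilinear_fps_split_right:
  assumes "bilinear_map (fps_scale scale) \<mu>"
  shows "\<mu> x y = \<mu> x (fps_const (y $ 0)) + fps_scale scale fps_X (\<mu> x (fps_shift 1 y))"
  using bilinear_fps_split_left[of "\<lambda>x y. \<mu> y x" y x] assms
  by (simp add: bilinear_map_def)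

lemma bilinear_fps_nth_0:
  assumes "bilinear_map (fps_scale scale) \<mu>"
  shows "\<mu> x y $ 0 = coeff_cochain \<mu> 0 (x $ 0) (y $ 0)"
proof -
  have "\<mu> x y $ 0 = \<mu> (fps_const (x $ 0)) y $ 0"
    by (subst bilinear_fps_split_left[OF assms]) (simp add: fps_scale_X_nth_0)
  also have "\<dots> = \<mu> (fps_const (x $ 0)) (fps_const (y $ 0)) $ 0"
    by (subst bilinear_fps_split_right[OF assms]) (simp add: fps_scale_X_nth_0)
  finally show ?thesis
    by (simp add: coeff_cochain_def)
qed

lemma bilinear_fps_nth_1:
  assumes "bilinear_map (fps_scale scale) \<mu>"
  shows "\<mu> x y $ 1 = infinitesimal \<mu> (x $ 0) (y $ 0)
    + coeff_cochain \<mu> 0 (x $ 1) (y $ 0) + coeff_cochain \<mu> 0 (x $ 0) (y $ 1)"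
proof -
  have X1: "fps_scale scale fps_X z $ 1 = z $ 0" for z
    using fps_scale_X_nth_Suc[of z 0] by simp
  have "\<mu> x y $ 1 = \<mu> (fps_const (x $ 0)) y $ 1 + \<mu> (fps_shift 1 x) y $ 0"
    by (subst bilinear_fps_split_left[OF assms]) (simp only: fps_add_nth X1)
  also have "\<mu> (fps_const (x $ 0)) y $ 1 =
      \<mu> (fps_const (x $ 0)) (fps_const (y $ 0)) $ 1 + \<mu> (fps_const (x $ 0)) (fps_shift 1 y) $ 0"
    by (subst bilinear_fps_split_right[OF assms]) (simp only: fps_add_nth X1)
  finally show ?thesis
    by (simp add: bilinear_fps_nth_0[OF assms] infinitesimal_def coeff_cochain_def[of \<mu> "Suc 0"])
qed

end

context leibniz_superalgebra
begin

lemma br_zero: "br x 0 = 0" "br 0 y = 0"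
proof -
  have "module_hom scale scale (br x)" "module_hom scale scale (\<lambda>x. br x y)"
    using br_C2 by (auto simp: C2_def bilinear_map_def)
  then show "br x 0 = 0" "br 0 y = 0"
    by (auto dest: module_hom.zero)
qed

lemma deformation_nth_0:
  assumes "formal_deformation \<mu>"
  shows "\<mu> x y $ 0 = br (x $ 0) (y $ 0)"
  using assms bilinear_fps_nth_0[of \<mu> x y] by (simp add: formal_deformation_def)

lemma deformation_nth_1:
  assumes "formal_deformation \<mu>"
  shows "\<mu> x y $ 1 =
    infinitesimal \<mu> (x $ 0) (y $ 0) + br (x $ 1) (y $ 0) + br (x $ 0) (y $ 1)"
  using assms bilinear_fps_nth_1[of \<mu> x y] by (simp add: formal_deformation_def)

text \<open>
  The cocycle condition is the coefficient of \<open>t\<close> in the Leibniz identity for \<open>\<mu>\<close>: each of the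
  three iterated products contributes one term with \<open>\<mu>\<^sub>1\<close> outside the bracket and one with
  \<open>\<mu>\<^sub>1\<close> inside, which are the six terms of \<open>\<delta>\<^sup>2 \<mu>\<^sub>1\<close>.
\<close>
lemma infinitesimal_in_Z2:
  assumes "formal_deformation \<mu>"
  shows "infinitesimal \<mu> \<in> Z2"
proof -
  have "infinitesimal \<mu> \<in> C2"
    using assms by (simp add: formal_deformation_def infinitesimal_def)
  moreover have "delta2 (infinitesimal \<mu>) \<alpha> \<beta> a b c = 0"
    if abc: "a \<in> L \<alpha>" "b \<in> L \<beta>" "c \<in> L \<gamma>" for \<alpha> \<beta> \<gamma> a b c
  proof -
    have leib: "\<mu> (\<mu> (fps_const a) (fps_const b)) (fps_const c) $ 1 =
        \<mu> (fps_const a) (\<mu> (fps_const b) (fps_const c)) $ 1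
        - koszul_sign \<alpha> \<beta> *s \<mu> (fps_const b) (\<mu> (fps_const a) (fps_const c)) $ 1"
      using assms abc by (auto simp: formal_deformation_def fps_scale_koszul_sign_nth)
    show ?thesis
      using leib
      by (simp add: deformation_nth_0[OF assms] deformation_nth_1[OF assms, unfolded One_nat_def]
          br_zero delta2_def scale_right_distrib algebra_simps)
  qed
  ultimately show ?thesis
    by (auto simp: Z2_def)
qed

text \<open>
  The 1-cochain that bounds \<open>\<mu>\<^sub>1 - \<mu>'\<^sub>1\<close> is the coefficient \<open>\<psi>\<^sub>1\<close> of the formal isomorphism; the
  sign depends on the direction in which \<open>\<Psi>\<close> goes.
\<close>
lemma infinitesimal_diff_in_B2:
  assumes \<mu>: "formal_deformation \<mu>" and \<mu>': "formal_deformation \<mu>'"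
    and iso: "formal_isomorphism \<Psi> \<mu> \<mu>'"
  shows "(\<lambda>x y. infinitesimal \<mu> x y - infinitesimal \<mu>' x y) \<in> B2"
proof -
  obtain \<psi> where \<psi>: "\<And>i. \<psi> i \<in> C1" "\<psi> 0 = id"
    and \<Psi>: "\<And>x n. \<Psi> x $ n = (\<Sum>i=0..n. \<psi> i (x $ (n - i)))"
    using iso by (auto simp: formal_isomorphism_def)
  have \<Psi>0: "\<Psi> x $ 0 = x $ 0" and \<Psi>1: "\<Psi> x $ 1 = x $ 1 + \<psi> 1 (x $ 0)" for x
    by (simp_all add: \<Psi> \<psi>)
  have "infinitesimal \<mu> a b - infinitesimal \<mu>' a b = delta1 (\<psi> 1) a b" for a b
  proof -
    have "\<mu>' (\<Psi> (fps_const a)) (\<Psi> (fps_const b)) $ 1 = \<Psi> (\<mu> (fps_const a) (fps_const b)) $ 1"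
      using iso by (simp add: formal_isomorphism_def)
    then have "infinitesimal \<mu>' a b + br (\<psi> 1 a) b + br a (\<psi> 1 b) =
        infinitesimal \<mu> a b + \<psi> 1 (br a b)"
      by (simp only: deformation_nth_1[OF \<mu>'] \<Psi>0 \<Psi>1 deformation_nth_1[OF \<mu>] deformation_nth_0[OF \<mu>])
         (simp add: br_zero)
    then show ?thesis
      by (simp add: delta1_def algebra_simps)
  qed
  then have "(\<lambda>x y. infinitesimal \<mu> x y - infinitesimal \<mu>' x y) = delta1 (\<psi> 1)"
    by (simp add: fun_eq_iff)
  then show ?thesis
    using \<psi>(1) by (simp add: B2_def)
qed

end

theorem theorem6p1:
  fixes scale :: "'k::field \<Rightarrow> 'v::ab_group_add \<Rightarrow> 'v"
    and L :: "bit \<Rightarrow> 'v set"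
    and br :: "'v \<Rightarrow> 'v \<Rightarrow> 'v"
    and \<mu> \<mu>' :: "'v fps \<Rightarrow> 'v fps \<Rightarrow> 'v fps"
  assumes "leibniz_superalgebra scale L br"
    and "leibniz_superalgebra.formal_deformation scale L br \<mu>"
    and "leibniz_superalgebra.formal_deformation scale L br \<mu>'"
    and "super_vector_space.equivalent_deformations scale L \<mu> \<mu>'"
  shows "\<exists>c \<in> leibniz_superalgebra.H2 scale L br.
           infinitesimal \<mu> \<in> c \<and>
           infinitesimal \<mu>' \<in> c"
proof -
  interpret leibniz_superalgebra scale L br by fact
  obtain \<Psi> where "formal_isomorphism \<Psi> \<mu> \<mu>'"
    using assms(4) by (auto simp: equivalent_deformations_def)
  then have rel: "(infinitesimal \<mu>, infinitesimal \<mu>') \<in> cohomologous"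
    using assms(2,3) infinitesimal_in_Z2 infinitesimal_diff_in_B2 by (simp add: cohomologous_def)
  have Z: "infinitesimal \<mu> \<in> Z2"
    using assms(2) by (rule infinitesimal_in_Z2)
  show ?thesis
  proof (intro bexI conjI)
    show "cohomologous `` {infinitesimal \<mu>} \<in> H2"
      using Z by (simp add: H2_def quotientI)
    show "infinitesimal \<mu> \<in> cohomologous `` {infinitesimal \<mu>}"
      using equiv_cohomologous Z by (rule equiv_class_self)
    show "infinitesimal \<mu>' \<in> cohomologous `` {infinitesimal \<mu>}"
      using rel by simp
  qed
qed

end
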